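(* Let $q$ be a prime power, let $r\geq 2$ be an integer, and let $t$ be a positive integer with $t\mid q-1$. Let $\mathbb{F}=\mathrm{GF}(q^{r-1})$ and let $H\subseteq\mathbb{F}^\ast$ be the subgroup of the multiplicative group of order $t(q^{r-2}+\cdots+q+1)$. Let $G(q^{r-1},t(q^{r-2}+\cdots+q+1))$ be the graph whose vertex set is $(\mathbb{F}\times\mathbb{F}\setminus\{(0,0)\})/\sim$, where $(a_1,b_1)\sim(a_2,b_2)$ iff there is $h\in H$ with $a_1=ha_2$ and $b_1=hb_2$, and in which two distinct vertices $\langle a,b\rangle$ and $\langle x,y\rangle$ are adjacent iff $ax+by\in H$. Then this graph is $K_{r,t^{r-1}(r-1)!+1}$-free.
   Context: $\langle a,b\rangle$ denotes the equivalence class of $(a,b)$; adjacency is independent of representatives; the graph is simple (no loops). A graph is $K_{s,u}$-free if it contains no (not necessarily induced) subgraph isomorphic to the complete bipartite graph $K_{s,u}$. *)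

theory Defs
  imports Main "HOL-Computational_Algebra.Primes"
begin

definition pair_rel :: "'a::field set \<Rightarrow> ('a \<times> 'a) rel" where
  "pair_rel H = {((a1,b1),(a2,b2)). (a1,b1) \<noteq> (0,0) \<and> (a2,b2) \<noteq> (0,0) \<and>
      (\<exists>h\<in>H. a1 = h * a2 \<and> b1 = h * b2)}"

definition G_verts :: "'a::field set \<Rightarrow> ('a \<times> 'a) set set" where
  "G_verts H = (UNIV - {(0,0)}) // pair_rel H"

text \<open>Adjacency: distinct classes <a,b>, <x,y> with a x + b y in H
  (independent of representatives).\<close>
definition G_adj :: "'a::field set \<Rightarrow> ('a \<times> 'a) set \<Rightarrow> ('a \<times> 'a) set \<Rightarrow> bool" where
  "G_adj H P Q = (P \<noteq> Q \<and> (\<exists>(a,b)\<in>P. \<exists>(x,y)\<in>Q. a * x + b * y \<in> H))"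

definition Ksu_free :: "'v set \<Rightarrow> ('v \<Rightarrow> 'v \<Rightarrow> bool) \<Rightarrow> nat \<Rightarrow> nat \<Rightarrow> bool" where
  "Ksu_free V adj s u = (\<not> (\<exists>S U. S \<subseteq> V \<and> U \<subseteq> V \<and> S \<inter> U = {} \<and>
      finite S \<and> finite U \<and> card S = s \<and> card U = u \<and> (\<forall>x\<in>S. \<forall>y\<in>U. adj x y)))"

definition prime_power :: "nat \<Rightarrow> bool" where
  "prime_power q = (\<exists>p k. prime p \<and> k > 0 \<and> q = p ^ k)"

end

theory Submission
  imports Defs "HOL-Computational_Algebra.Polynomial" "HOL-Library.Function_Algebras" "HOL-Library.FuncSet"
begin

text \<open>
  Write \<open>s = r - 1\<close> and let \<open>N z = z ^ (1 + q + \<dots> + q ^ (s - 1))\<close> be the norm. It maps \<open>H\<close> into the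
  \<open>t\<close>-th roots of unity. If \<open>r\<close> vertices have a common neighbour, then their representatives are pairwise
  linearly independent. Scaling a common neighbour so that its product with the last vertex
  is \<open>1\<close> puts it on an affine line with parameter \<open>z\<close>, and the other \<open>s\<close> adjacencies prescribe
  \<open>N (z - e i)\<close> up to a \<open>t\<close>-th root of unity, for distinct \<open>e 0, \<dots>, e (s - 1)\<close>. That leaves
  \<open>t ^ s\<close> systems \<open>N (z - e i) = B i\<close>, each with at most \<open>s!\<close> solutions.

  The last bound holds for every system \<open>\<Prod>j<s. x j - a i j = b i\<close> (\<open>i < s\<close>) in which, for each \<open>j\<close>, the
  \<open>a i j\<close> are distinct (Kollar, Ronyai, Szabo). Instead of the usual algebraic geometry, we show
  that the \<open>s!\<close> monomials \<open>\<Prod>j<s. x j ^ \<alpha> j\<close> with \<open>\<alpha> j \<le> j\<close> span all functions on the solution set: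
  by Lagrange interpolation, a monomial in the variables other than \<open>x j\<close> whose degree bounds dominate a
  staircase is a combination of the \<open>s\<close> products \<open>\<Prod>k\<noteq>j. x k - a i k\<close>, and multiplying it by \<open>x j\<close>
  then allows the equations to be used to lower the degree in \<open>x j\<close>.
\<close>

section \<open>Vector spaces of functions\<close>

interpretation fn: vector_space "\<lambda>(c::'a::field) (f :: 'b \<Rightarrow> 'a) x. c * f x"
  by standard (auto simp: fun_eq_iff algebra_simps)

text \<open>Pointwise multiplication by \<open>\<phi>\<close> is linear, so it is enough to control
  it on generators.\<close>

lemma fn_span_mult:
  fixes f \<phi> :: "'b \<Rightarrow> 'a::field"
  assumes "f \<in> fn.span A" and "\<And>g. g \<in> A \<Longrightarrow> (\<lambda>x. \<phi> x * g x) \<in> fn.span B"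
  shows "(\<lambda>x. \<phi> x * f x) \<in> fn.span B"
  using assms(1)
proof (induction rule: fn.span_induct_alt)
  case base
  have "(\<lambda>x. \<phi> x * (0 :: 'b \<Rightarrow> 'a) x) = 0" by (auto simp: fun_eq_iff)
  then show ?case using fn.span_zero[of B] by simp
next
  case (step c g h)
  have eq: "(\<lambda>x. \<phi> x * ((\<lambda>x. c * g x) + h) x) = (\<lambda>x. c * (\<phi> x * g x)) + (\<lambda>x. \<phi> x * h x)"
    by (auto simp: fun_eq_iff algebra_simps)
  show ?case unfolding eq
    by (intro fn.span_add step.IH fn.span_scale assms(2) step.hyps)
qed

lemma fn_span_lincomb:
  fixes g :: "'i \<Rightarrow> 'b \<Rightarrow> 'a::field"
  assumes "\<And>i. i \<in> I \<Longrightarrow> g i \<in> fn.span B"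
  shows "(\<lambda>x. \<Sum>i\<in>I. c i * g i x) \<in> fn.span B"
  using assms
proof (induction I rule: infinite_finite_induct)
  case (insert i I)
  have eq: "(\<lambda>x. \<Sum>i\<in>insert i I. c i * g i x) = (\<lambda>x. c i * g i x) + (\<lambda>x. \<Sum>i\<in>I. c i * g i x)"
    using insert.hyps by (auto simp: fun_eq_iff)
  show ?case unfolding eq using insert by (intro fn.span_add fn.span_scale) auto
qed (use fn.span_zero[of B] in \<open>auto simp: zero_fun_def\<close>)

section \<open>Products of linear factors and Lagrange interpolation\<close>

lemma degree_prod_linear:
  fixes a :: "'i \<Rightarrow> 'a::field"
  shows "finite L \<Longrightarrow> degree (\<Prod>l\<in>L. [:- a l, 1:]) = card L"
  by (subst degree_prod_eq_sum_degree) auto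

lemma prod_linear_expansion:
  fixes a :: "'i \<Rightarrow> 'a::field"
  assumes "finite L"
  obtains c where "\<And>x. (\<Prod>l\<in>L. x - a l) = (\<Sum>m\<le>card L. c m * x ^ m)"
proof
  fix x
  have "(\<Prod>l\<in>L. x - a l) = poly (\<Prod>l\<in>L. [:- a l, 1:]) x"
    by (simp add: poly_prod algebra_simps)
  then show "(\<Prod>l\<in>L. x - a l) = (\<Sum>m\<le>card L. coeff (\<Prod>l\<in>L. [:- a l, 1:]) m * x ^ m)"
    by (simp add: poly_altdef degree_prod_linear assms)
qed

text \<open>Both sides are polynomials of degree below \<open>card I\<close> and agree at the
  \<open>card I\<close> distinct nodes \<open>a i\<close>.\<close>

lemma lagrange_power_expansion:
  fixes a :: "'i \<Rightarrow> 'a::field"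
  assumes I: "finite I" "inj_on a I" and m: "m < card I"
  obtains c where "\<And>x. x ^ m = (\<Sum>i\<in>I. c i * (\<Prod>l\<in>I - {i}. x - a l))"
proof -
  define c where "c i = a i ^ m / (\<Prod>l\<in>I - {i}. a i - a l)" for i
  define P where "P i = (\<Prod>l\<in>I - {i}. [:- a l, 1:])" for i
  have P: "poly (P i) x = (\<Prod>l\<in>I - {i}. x - a l)" for i x
    by (simp add: P_def poly_prod algebra_simps)
  have "degree (\<Sum>i\<in>I. smult (c i) (P i)) \<le> card I - 1"
  proof (intro degree_sum_le I)
    fix i assume "i \<in> I"
    then have "degree (P i) = card I - 1"
      by (simp add: P_def degree_prod_linear I)
    then show "degree (smult (c i) (P i)) \<le> card I - 1"
      using degree_smult_le[of "c i" "P i"] by simp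
  qed
  moreover have "poly (monom 1 m) y = poly (\<Sum>i\<in>I. smult (c i) (P i)) y" if y: "y \<in> a ` I" for y
  proof -
    obtain j where j: "j \<in> I" "y = a j" using y by auto
    have "(\<Prod>l\<in>I - {i}. y - a l) = 0" if "i \<in> I - {j}" for i
      using j that I by auto
    then have "(\<Sum>i\<in>I - {j}. c i * (\<Prod>l\<in>I - {i}. y - a l)) = 0"
      by (intro sum.neutral) simp
    then have "(\<Sum>i\<in>I. c i * (\<Prod>l\<in>I - {i}. y - a l)) = c j * (\<Prod>l\<in>I - {j}. y - a l)"
      using j I by (subst sum.remove[of _ j]) auto
    moreover have "(\<Prod>l\<in>I - {j}. y - a l) \<noteq> 0"
      using j I by (auto simp: inj_on_def)
    ultimately show ?thesis
      using j by (simp add: poly_sum P poly_monom c_def)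
  qed
  ultimately have "monom 1 m = (\<Sum>i\<in>I. smult (c i) (P i))"
    using m by (intro poly_eqI_degree[of "a ` I"]) (auto simp: card_image I degree_monom_eq)
  then have "poly (monom 1 m) x = poly (\<Sum>i\<in>I. smult (c i) (P i)) x" for x
    by simp
  then have "x ^ m = (\<Sum>i\<in>I. c i * (\<Prod>l\<in>I - {i}. x - a l))" for x
    by (simp add: poly_monom poly_sum P)
  then show ?thesis by (rule that)
qed

section \<open>Monomials as combinations of products\<close>

definition mon :: "nat set \<Rightarrow> (nat \<Rightarrow> nat) \<Rightarrow> (nat \<Rightarrow> 'a::field) \<Rightarrow> 'a" where
  "mon J \<alpha> x = (\<Prod>k\<in>J. x k ^ \<alpha> k)"

lemma mon_insert:
  "finite J \<Longrightarrow> b \<notin> J \<Longrightarrow> mon (insert b J) \<alpha> x = x b ^ \<alpha> b * mon J \<alpha> x"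
  by (simp add: mon_def)

lemma mon_cong: "(\<And>k. k \<in> J \<Longrightarrow> \<alpha> k = \<beta> k) \<Longrightarrow> mon J \<alpha> x = mon J \<beta> x"
  by (simp add: mon_def)

lemma mon_fun_upd_insert:
  "finite J \<Longrightarrow> b \<notin> J \<Longrightarrow> mon (insert b J) (\<alpha>(b := m)) x = x b ^ m * mon J \<alpha> x"
  by (auto simp: mon_insert intro: mon_cong)

text \<open>
  Interpolating in the largest variable \<open>x b\<close> reduces the claim to products vanishing at all nodes
  \<open>a l b\<close> but one, \<open>a i b\<close>; such a product absorbs the factor \<open>x b - a l b\<close> missing from the
  smaller system indexed by \<open>I - {i}\<close>.
\<close>

lemma mon_in_span_products:
  fixes a :: "'i \<Rightarrow> nat \<Rightarrow> 'a::field"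
  assumes "finite J" and "finite I" and "card I = Suc (card J)"
    and "\<And>k. k \<in> J \<Longrightarrow> inj_on (\<lambda>i. a i k) I"
    and "\<And>k. k \<in> J \<Longrightarrow> card {k'\<in>J. k' \<le> k} \<le> d k"
    and "\<And>k. k \<in> J \<Longrightarrow> \<alpha> k \<le> d k"
  shows "mon J \<alpha> \<in> fn.span {\<lambda>x. (\<Prod>k\<in>J. x k - a i k) * mon J \<beta> x | i \<beta>. i \<in> I \<and> (\<forall>k\<in>J. \<beta> k < d k)}"
  using assms
proof (induction J arbitrary: I rule: finite_linorder_max_induct)
  case empty
  then obtain i where "i \<in> I" by fastforce
  then show ?case
    by (intro fn.span_base) (auto simp: mon_def fun_eq_iff)
next
  case (insert b J)
  define n where "n = Suc (card J)"
  have b: "b \<notin> J" using insert.hyps by auto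
  let ?B = "{\<lambda>x. (\<Prod>k\<in>insert b J. x k - a i k) * mon (insert b J) \<beta> x | i \<beta>.
    i \<in> I \<and> (\<forall>k\<in>insert b J. \<beta> k < d k)}"
  have cI: "card I = Suc n" using insert.prems(2) insert.hyps b by (simp add: n_def)
  have "{k' \<in> insert b J. k' \<le> b} = insert b J" using insert.hyps by auto
  then have nd: "n \<le> d b"
    using insert.prems(4)[of b] insert.hyps b by (simp add: n_def)
  have cJ: "card {k' \<in> J. k' \<le> k} \<le> d k" if "k \<in> J" for k
  proof -
    have "{k' \<in> insert b J. k' \<le> k} = {k' \<in> J. k' \<le> k}" using insert.hyps that by auto
    then show ?thesis using insert.prems(4)[of k] that by simp
  qed
  have key: "(\<lambda>x. x b ^ e * (\<Prod>l\<in>I - {i}. x b - a l b) * mon J \<alpha> x) \<in> fn.span ?B"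
    if i: "i \<in> I" and e: "e + n \<le> d b" for i e
  proof (rule fn_span_mult)
    show "mon J \<alpha> \<in> fn.span {\<lambda>x. (\<Prod>k\<in>J. x k - a l k) * mon J \<beta> x | l \<beta>.
        l \<in> I - {i} \<and> (\<forall>k\<in>J. \<beta> k < d k)}"
    proof (rule insert.IH)
      show "card (I - {i}) = Suc (card J)" using cI i insert.prems(1) by (simp add: n_def)
      show "inj_on (\<lambda>l. a l k) (I - {i})" if "k \<in> J" for k
        using insert.prems(3)[of k] that by (auto intro: inj_on_subset)
    qed (use insert.prems cJ in auto)
  next
    fix g :: "(nat \<Rightarrow> 'a) \<Rightarrow> 'a"
    assume "g \<in> {\<lambda>x. (\<Prod>k\<in>J. x k - a l k) * mon J \<beta> x | l \<beta>.
        l \<in> I - {i} \<and> (\<forall>k\<in>J. \<beta> k < d k)}"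
    then obtain l \<beta> where g: "g = (\<lambda>x. (\<Prod>k\<in>J. x k - a l k) * mon J \<beta> x)"
      and l: "l \<in> I" "l \<noteq> i" and \<beta>: "\<And>k. k \<in> J \<Longrightarrow> \<beta> k < d k" by auto
    have fin: "finite (I - {i} - {l})" using insert.prems(1) by simp
    have card: "card (I - {i} - {l}) = n - 1"
      using l i cI insert.prems(1) by simp
    obtain c where c: "\<And>y. (\<Prod>l'\<in>I - {i} - {l}. y - a l' b) = (\<Sum>m\<le>n - 1. c m * y ^ m)"
      using prod_linear_expansion[OF fin, of "\<lambda>l'. a l' b"] card by metis
    let ?h = "\<lambda>m x. (\<Prod>k\<in>insert b J. x k - a l k) * mon (insert b J) (\<beta>(b := e + m)) x"
    have "x b ^ e * (\<Prod>l\<in>I - {i}. x b - a l b) * g x = (\<Sum>m\<le>n - 1. c m * ?h m x)" for x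
    proof -
      have "(\<Prod>l\<in>I - {i}. x b - a l b) = (x b - a l b) * (\<Sum>m\<le>n - 1. c m * x b ^ m)"
        using l insert.prems(1) by (subst prod.remove[of _ l]) (auto simp: c)
      then show ?thesis
        using b insert.hyps
        by (simp add: g mon_fun_upd_insert sum_distrib_left sum_distrib_right power_add mult_ac)
    qed
    moreover have "(\<lambda>x. \<Sum>m\<le>n - 1. c m * ?h m x) \<in> fn.span ?B"
    proof (intro fn_span_lincomb fn.span_base)
      fix m assume "m \<in> {..n - 1}"
      \<comment> \<open>The product over the \<open>n - 1\<close> nodes other than
        \<open>a i b\<close> and \<open>a l b\<close> has degree \<open>n - 1\<close>, hence
        \<open>e + m < e + n \<le> d b\<close>. This is where the strict bound on the exponent of
        \<open>x b\<close> comes from.\<close>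
      then have "\<forall>k\<in>insert b J. (\<beta>(b := e + m)) k < d k" using \<beta> e by (auto simp: n_def)
      then show "?h m \<in> ?B" using l by blast
    qed
    ultimately show "(\<lambda>x. x b ^ e * (\<Prod>l\<in>I - {i}. x b - a l b) * g x) \<in> fn.span ?B"
      by simp
  qed
  \<comment> \<open>Interpolation on \<open>n + 1\<close> nodes reaches powers up to
    \<open>n\<close> only. The excess power \<open>e\<close> is carried along as a factor, and
    \<open>e + n \<le> d b\<close> holds whether or not \<open>\<alpha> b\<close> exceeds
    \<open>n\<close>.\<close>
  define m where "m = min (\<alpha> b) n"
  define e where "e = \<alpha> b - m"
  have em: "\<alpha> b = e + m" "m < card I" "e + n \<le> d b"
    using insert.prems(5)[of b] nd by (auto simp: m_def e_def cI)
  obtain c where c: "\<And>y. y ^ m = (\<Sum>i\<in>I. c i * (\<Prod>l\<in>I - {i}. y - a l b))"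
    using lagrange_power_expansion[OF insert.prems(1) _ em(2), of "\<lambda>i. a i b"]
      insert.prems(3)[of b] by auto
  have "mon (insert b J) \<alpha>
    = (\<lambda>x. \<Sum>i\<in>I. c i * (x b ^ e * (\<Prod>l\<in>I - {i}. x b - a l b) * mon J \<alpha> x))"
    using b insert.hyps
    by (simp add: fun_eq_iff mon_insert em(1) power_add c sum_distrib_left sum_distrib_right mult_ac)
  also have "\<dots> \<in> fn.span ?B"
    using em by (intro fn_span_lincomb key) auto
  finally show ?case .
qed

section \<open>Product systems and the functions on their solution sets\<close>

text \<open>Extension by zero models a function on \<open>Z\<close>, so that relations valid only on
  solutions become equalities of total functions.\<close>

definition mon_on :: "(nat \<Rightarrow> 'a) set \<Rightarrow> nat \<Rightarrow> (nat \<Rightarrow> nat) \<Rightarrow> (nat \<Rightarrow> 'a::field) \<Rightarrow> 'a" where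
  "mon_on Z s \<alpha> x = (if x \<in> Z then mon {..<s} \<alpha> x else 0)"

text \<open>For \<open>d k = k\<close> the exponents below \<open>s\<close> form the staircase, with
  \<open>1 * 2 * ... * s = s!\<close> members.\<close>

definition box_span :: "(nat \<Rightarrow> 'a::field) set \<Rightarrow> nat \<Rightarrow> (nat \<Rightarrow> nat) \<Rightarrow> ((nat \<Rightarrow> 'a) \<Rightarrow> 'a) set" where
  "box_span Z s d = fn.span {mon_on Z s \<alpha> | \<alpha>. \<forall>k<s. \<alpha> k \<le> d k}"

lemma mon_on_in_box_span: "(\<And>k. k < s \<Longrightarrow> \<alpha> k \<le> d k) \<Longrightarrow> mon_on Z s \<alpha> \<in> box_span Z s d"
  unfolding box_span_def by (intro fn.span_base) auto

lemma box_span_least: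
  assumes "\<And>\<alpha>. (\<And>k. k < s \<Longrightarrow> \<alpha> k \<le> d k) \<Longrightarrow> mon_on Z s \<alpha> \<in> box_span Z s d'"
  shows "box_span Z s d \<subseteq> box_span Z s d'"
  using assms unfolding box_span_def by (intro fn.span_minimal fn.subspace_span) auto

text \<open>A point has infinitely many coordinates, of which the equations see the first
  \<open>s\<close>; \<open>separated\<close> ensures that these already distinguish the points of
  \<open>Z\<close>.\<close>

locale product_system =
  fixes s :: nat and a :: "nat \<Rightarrow> nat \<Rightarrow> 'a::field" and b :: "nat \<Rightarrow> 'a"
    and Z :: "(nat \<Rightarrow> 'a) set"
  assumes inj: "\<And>j. j < s \<Longrightarrow> inj_on (\<lambda>i. a i j) {..<s}"
    and eqs: "\<And>x i. x \<in> Z \<Longrightarrow> i < s \<Longrightarrow> (\<Prod>j<s. x j - a i j) = b i"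
    and finite_Z: "finite Z"
    and separated: "\<And>x y. x \<in> Z \<Longrightarrow> y \<in> Z \<Longrightarrow> (\<And>j. j < s \<Longrightarrow> x j = y j) \<Longrightarrow> x = y"
begin

text \<open>
  On \<open>Z\<close>, the equation gives \<open>x j * G = a i j * G + b i\<close> for \<open>G = (\<Prod>k\<noteq>j. x k - a i k)\<close>, which removes one
  factor \<open>x j\<close> without raising the degree in any other variable beyond its bound.
\<close>

lemma box_span_lower_degree:
  assumes j: "j < s"
    and d: "\<And>k. k \<in> {..<s} - {j} \<Longrightarrow> card {k'\<in>{..<s} - {j}. k' \<le> k} \<le> d k"
  shows "box_span Z s (d(j := Suc m)) \<subseteq> box_span Z s (d(j := m))"
proof (rule box_span_least)
  fix \<alpha> assume \<alpha>: "\<And>k. k < s \<Longrightarrow> \<alpha> k \<le> (d(j := Suc m)) k"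
  define J where "J = {..<s} - {j}"
  have J: "finite J" "j \<notin> J" and ins: "{..<s} = insert j J" using j by (auto simp: J_def)
  have cJ: "card {..<s} = Suc (card J)" unfolding ins using J by simp
  show "mon_on Z s \<alpha> \<in> box_span Z s (d(j := m))"
  proof (cases "\<alpha> j \<le> m")
    case True
    have "\<alpha> k \<le> (d(j := m)) k" if "k < s" for k
      using \<alpha>[OF that] True by (cases "k = j") auto
    then show ?thesis by (rule mon_on_in_box_span)
  next
    case False
    then have \<alpha>j: "\<alpha> j = Suc m" using \<alpha>[OF j] by simp
    \<comment> \<open>The factor \<open>x j ^ Suc m\<close> is cut off outside \<open>Z\<close>,
      since the equations may be used only on \<open>Z\<close>.\<close>
    let ?\<phi> = "\<lambda>x. if x \<in> Z then x j ^ Suc m else 0"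
    have "mon J \<alpha> \<in> fn.span {\<lambda>x. (\<Prod>k\<in>J. x k - a i k) * mon J \<beta> x | i \<beta>.
        i \<in> {..<s} \<and> (\<forall>k\<in>J. \<beta> k < d k)}"
    proof (rule mon_in_span_products)
      show "\<alpha> k \<le> d k" if "k \<in> J" for k
        using \<alpha>[of k] that by (auto simp: J_def)
    qed (use J cJ inj d in \<open>auto simp: J_def\<close>)
    then have "(\<lambda>x. ?\<phi> x * mon J \<alpha> x) \<in> box_span Z s (d(j := m))"
      unfolding box_span_def
    proof (rule fn_span_mult)
      fix g :: "(nat \<Rightarrow> 'a) \<Rightarrow> 'a"
      assume "g \<in> {\<lambda>x. (\<Prod>k\<in>J. x k - a i k) * mon J \<beta> x | i \<beta>.
        i \<in> {..<s} \<and> (\<forall>k\<in>J. \<beta> k < d k)}"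
      then obtain i \<beta> where g: "g = (\<lambda>x. (\<Prod>k\<in>J. x k - a i k) * mon J \<beta> x)"
        and i: "i < s" and \<beta>: "\<And>k. k \<in> J \<Longrightarrow> \<beta> k < d k" by auto
      show "(\<lambda>x. ?\<phi> x * g x) \<in> fn.span {mon_on Z s \<alpha> | \<alpha>. \<forall>k<s. \<alpha> k \<le> (d(j := m)) k}"
      proof -
        \<comment> \<open>\<open>T\<close> is the set of factors that contribute \<open>x k\<close>.
          Each exponent rises by at most one, so \<open>\<beta> k < d k\<close> keeps every
          resulting monomial within the bounds \<open>d\<close>.\<close>
        have expand: "(\<Prod>k\<in>J. x k - a i k) * mon J \<beta> x
          = (\<Sum>T\<in>Pow J. (\<Prod>k\<in>J - T. - a i k) * mon J (\<lambda>k. if k \<in> T then Suc (\<beta> k) else \<beta> k) x)" for x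
        proof -
          have expand_prod: "(\<Prod>k\<in>J. x k + (- a i k)) = (\<Sum>T\<in>Pow J. (\<Prod>k\<in>T. x k) * (\<Prod>k\<in>J - T. - a i k))"
            using J by (intro prod_add)
          have shift: "(\<Prod>k\<in>T. x k) * mon J \<beta> x = mon J (\<lambda>k. if k \<in> T then Suc (\<beta> k) else \<beta> k) x"
            if "T \<subseteq> J" for T
          proof -
            have "(\<Prod>k\<in>T. x k) = (\<Prod>k\<in>J. if k \<in> T then x k else 1)"
              using that J by (simp add: prod.If_cases Int_absorb1)
            then show ?thesis
              unfolding mon_def prod.distrib[symmetric] by (auto simp: prod.distrib[symmetric] intro!: prod.cong)
          qed
          have "(\<Prod>k\<in>T. x k) * (\<Prod>k\<in>J - T. - a i k) * mon J \<beta> x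
            = (\<Prod>k\<in>J - T. - a i k) * mon J (\<lambda>k. if k \<in> T then Suc (\<beta> k) else \<beta> k) x"
            if "T \<in> Pow J" for T
            using shift[of T, symmetric] that by (simp add: mult_ac)
          then have "(\<Sum>T\<in>Pow J. (\<Prod>k\<in>T. x k) * (\<Prod>k\<in>J - T. - a i k) * mon J \<beta> x) =
            (\<Sum>T\<in>Pow J. (\<Prod>k\<in>J - T. - a i k) * mon J (\<lambda>k. if k \<in> T then Suc (\<beta> k) else \<beta> k) x)"
            by (rule sum.cong[OF refl])
          then show ?thesis
            using expand_prod by (simp add: sum_distrib_right)
        qed
        let ?A = "\<lambda>x. \<Sum>T\<in>Pow J. (a i j * (\<Prod>k\<in>J - T. - a i k)) *
          mon_on Z s ((\<lambda>k. if k \<in> T then Suc (\<beta> k) else \<beta> k)(j := m)) x"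
        let ?C = "\<lambda>x. b i * mon_on Z s (\<beta>(j := m)) x"
        have "?\<phi> x * g x = ?A x + ?C x" for x
        proof (cases "x \<in> Z")
          case True
          have G: "x j * (\<Prod>k\<in>J. x k - a i k) = a i j * (\<Prod>k\<in>J. x k - a i k) + b i"
            using eqs[OF True i] J unfolding ins by (simp add: algebra_simps)
          have "x j ^ Suc m * g x = x j ^ m * (x j * (\<Prod>k\<in>J. x k - a i k)) * mon J \<beta> x"
            by (simp add: g mult_ac)
          also have "\<dots> = a i j * (x j ^ m * ((\<Prod>k\<in>J. x k - a i k) * mon J \<beta> x)) + b i * (x j ^ m * mon J \<beta> x)"
            unfolding G by (simp add: algebra_simps)
          also have "\<dots> = ?A x + ?C x"
            using True J unfolding expand mon_on_def ins
            by (simp add: mon_fun_upd_insert sum_distrib_left mult_ac)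
          finally show ?thesis using True by simp
        qed (simp add: mon_on_def)
        then have "(\<lambda>x. ?\<phi> x * g x) = ?A + ?C" by (simp add: fun_eq_iff)
        also have "\<dots> \<in> box_span Z s (d(j := m))"
          unfolding box_span_def
        proof (intro fn.span_add fn.span_scale fn_span_lincomb; unfold box_span_def[symmetric])
          show "mon_on Z s ((\<lambda>k. if k \<in> T then Suc (\<beta> k) else \<beta> k)(j := m)) \<in> box_span Z s (d(j := m))" for T
            using \<beta> by (intro mon_on_in_box_span) (auto simp: J_def Suc_le_eq less_imp_le)
          show "mon_on Z s (\<beta>(j := m)) \<in> box_span Z s (d(j := m))"
            using \<beta> by (intro mon_on_in_box_span) (auto simp: J_def less_imp_le)
        qed
        finally show ?thesis unfolding box_span_def .
      qed
    qed
    moreover have "(\<lambda>x. ?\<phi> x * mon J \<alpha> x) = mon_on Z s \<alpha>"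
      using J by (simp add: fun_eq_iff mon_on_def ins mon_insert \<alpha>j)
    ultimately show ?thesis by simp
  qed
qed

text \<open>The bounds are lowered from the largest index downwards: when coordinate
  \<open>j\<close> goes from \<open>M\<close> to \<open>j\<close>, those above it already have their
  final bound and those below it still have \<open>M\<close>.\<close>

lemma box_span_staircase:
  assumes "s \<le> M" and "j \<le> s"
  shows "box_span Z s (\<lambda>k. if k < j then M else k) \<subseteq> box_span Z s (\<lambda>k. k)"
  using assms(2)
proof (induction j)
  case (Suc j)
  then have j: "j < s" by simp
  let ?d = "\<lambda>k. if k < j then M else k"
  \<comment> \<open>Below \<open>j\<close> the count is at most
    \<open>k + 1 \<le> s \<le> M\<close>. Above \<open>j\<close> the omitted index \<open>j\<close>
    brings it down from \<open>k + 1\<close> to exactly the bound \<open>k\<close>.\<close>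
  have d: "card {k'\<in>{..<s} - {j}. k' \<le> k} \<le> ?d k" if k: "k \<in> {..<s} - {j}" for k
  proof (cases "k < j")
    case True
    have "card {k'\<in>{..<s} - {j}. k' \<le> k} \<le> card {..k}" by (intro card_mono) auto
    then show ?thesis using True assms(1) j by simp
  next
    case False
    then have "card {k'\<in>{..<s} - {j}. k' \<le> k} \<le> card ({..k} - {j})" by (intro card_mono) auto
    also have "\<dots> = k" using False k by simp
    finally show ?thesis using False by simp
  qed
  have "box_span Z s (?d(j := j + n)) \<subseteq> box_span Z s (?d(j := j))" for n
  proof (induction n)
    case (Suc n)
    have "box_span Z s (?d(j := Suc (j + n))) \<subseteq> box_span Z s (?d(j := j + n))"
      by (rule box_span_lower_degree[OF j d])
    with Suc show ?case unfolding add_Suc_right by (rule order_trans[rotated])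
  qed simp
  from this[of "M - j"] have "box_span Z s (?d(j := M)) \<subseteq> box_span Z s (?d(j := j))"
    using j assms(1) by simp
  moreover have "?d(j := M) = (\<lambda>k. if k < Suc j then M else k)" "?d(j := j) = ?d"
    by (auto simp: fun_eq_iff)
  ultimately show ?case using Suc by simp
qed simp

text \<open>Any exponent vector fits under a constant bound \<open>M \<ge> s\<close>, from which all
  \<open>s\<close> coordinates can be lowered.\<close>

lemma mon_on_in_staircase: "mon_on Z s \<alpha> \<in> box_span Z s (\<lambda>k. k)"
proof -
  define M where "M = s + (\<Sum>k<s. \<alpha> k)"
  have "\<alpha> k \<le> M" if "k < s" for k
    using member_le_sum[of k "{..<s}" \<alpha>] that by (simp add: M_def)
  then have "mon_on Z s \<alpha> \<in> box_span Z s (\<lambda>k. if k < s then M else k)"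
    by (intro mon_on_in_box_span) auto
  then show ?thesis using box_span_staircase[of M s] by (auto simp: M_def)
qed

text \<open>Multiplying a generator by \<open>x j\<close> gives a monomial again, possibly outside
  the staircase, but every monomial lies in the span.\<close>

lemma mult_coordinate_in_staircase:
  assumes f: "f \<in> box_span Z s (\<lambda>k. k)" and j: "j < s"
  shows "(\<lambda>x. (x j - c) * f x) \<in> box_span Z s (\<lambda>k. k)"
  unfolding box_span_def
proof (rule fn_span_mult)
  show "f \<in> fn.span {mon_on Z s \<alpha> | \<alpha>. \<forall>k<s. \<alpha> k \<le> k}" using f by (simp add: box_span_def)
  fix g assume "g \<in> {mon_on Z s \<alpha> | \<alpha>. \<forall>k<s. \<alpha> k \<le> k}"
  then obtain \<alpha> where g: "g = mon_on Z s \<alpha>" by auto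
  define J where "J = {..<s} - {j}"
  have J: "finite J" "j \<notin> J" and ins: "{..<s} = insert j J" using j by (auto simp: J_def)
  have "mon {..<s} (\<alpha>(j := Suc (\<alpha> j))) x = x j * mon {..<s} \<alpha> x" for x :: "nat \<Rightarrow> 'a"
    unfolding ins by (subst mon_fun_upd_insert[OF J], subst mon_insert[OF J]) simp
  then have "(\<lambda>x. (x j - c) * g x) = mon_on Z s (\<alpha>(j := Suc (\<alpha> j))) - (\<lambda>x. c * mon_on Z s \<alpha> x)"
    by (simp add: fun_eq_iff g mon_on_def algebra_simps)
  also have "\<dots> \<in> fn.span {mon_on Z s \<alpha> | \<alpha>. \<forall>k<s. \<alpha> k \<le> k}"
    using mon_on_in_staircase[unfolded box_span_def] by (intro fn.span_diff fn.span_scale)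
  finally show "(\<lambda>x. (x j - c) * g x) \<in> fn.span {mon_on Z s \<alpha> | \<alpha>. \<forall>k<s. \<alpha> k \<le> k}" .
qed

text \<open>The indicator is a product over the other points \<open>y\<close> of \<open>Z\<close> of
  factors \<open>(x j - y j) / (p j - y j)\<close>, where \<open>j\<close> is a coordinate in which
  \<open>p\<close> and \<open>y\<close> differ.\<close>

lemma indicator_in_staircase:
  assumes p: "p \<in> Z"
  shows "(\<lambda>x. if x = p then 1 else 0) \<in> box_span Z s (\<lambda>k. k)"
proof -
  have step: "\<exists>f \<in> box_span Z s (\<lambda>k. k). f p = 1 \<and> (\<forall>x. x \<notin> Z \<or> x \<in> Q \<longrightarrow> f x = 0)"
    if "Q \<subseteq> Z - {p}" for Q
  proof -
    have "finite Q" using that finite_Z finite_subset by blast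
    then show ?thesis using that
    proof (induction Q)
      case empty
      \<comment> \<open>The monomial with all exponents zero is the indicator of
        \<open>Z\<close>.\<close>
      have "mon_on Z s (\<lambda>_. 0) p = 1" "\<forall>x. x \<notin> Z \<longrightarrow> mon_on Z s (\<lambda>_. 0) x = 0"
        using p by (auto simp: mon_on_def mon_def)
      then show ?case using mon_on_in_staircase by blast
    next
      case (insert y Q)
      then obtain f where f: "f \<in> box_span Z s (\<lambda>k. k)" "f p = 1" "\<forall>x. x \<notin> Z \<or> x \<in> Q \<longrightarrow> f x = 0"
        by auto
      obtain j where j: "j < s" "p j \<noteq> y j" using separated[OF p, of y] insert.prems by blast
      let ?f = "\<lambda>x. inverse (p j - y j) * ((x j - y j) * f x)"
      have "?f \<in> box_span Z s (\<lambda>k. k)"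
        using mult_coordinate_in_staircase[OF f(1) j(1), of "y j"]
        unfolding box_span_def by (rule fn.span_scale)
      moreover have "?f p = 1 \<and> (\<forall>x. x \<notin> Z \<or> x \<in> insert y Q \<longrightarrow> ?f x = 0)" using f j by auto
      ultimately show ?case by (intro bexI[of _ ?f])
    qed
  qed
  from step[OF order_refl] obtain f where f: "f \<in> box_span Z s (\<lambda>k. k)" "f p = 1"
    and zero: "\<And>x. x \<notin> Z \<or> x \<in> Z - {p} \<Longrightarrow> f x = 0" by auto
  have "f = (\<lambda>x. if x = p then 1 else 0)"
  proof
    show "f x = (if x = p then 1 else 0)" for x
      using f(2) zero[of x] by (cases "x = p") auto
  qed
  then show ?thesis using f(1) by simp
qed

text \<open>The indicators of the points of \<open>Z\<close> are linearly independent and lie in a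
  space spanned by \<open>s!\<close> functions.\<close>

theorem card_solutions_le_fact: "card Z \<le> fact s"
proof -
  define \<delta> :: "(nat \<Rightarrow> 'a) \<Rightarrow> (nat \<Rightarrow> 'a) \<Rightarrow> 'a" where "\<delta> p = (\<lambda>x. if x = p then 1 else 0)" for p
  have inj_\<delta>: "inj \<delta>"
  proof (rule injI)
    fix p q assume "\<delta> p = \<delta> q"
    then have "\<delta> p p = \<delta> q p" by simp
    then show "p = q" by (auto simp: \<delta>_def split: if_splits)
  qed
  \<comment> \<open>Exponents at \<open>s\<close> and beyond do not affect \<open>mon_on\<close>.
    Fixing them makes the index set finite, with \<open>k + 1\<close> choices for exponent
    \<open>k\<close>.\<close>
  let ?W = "PiE {..<s} (\<lambda>k. {..k})"
  have gen: "{mon_on Z s \<alpha> | \<alpha>. \<forall>k<s. \<alpha> k \<le> k} = mon_on Z s ` ?W"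
  proof (intro equalityI subsetI)
    fix f assume "f \<in> {mon_on Z s \<alpha> | \<alpha>. \<forall>k<s. \<alpha> k \<le> k}"
    then obtain \<alpha> where \<alpha>: "f = mon_on Z s \<alpha>" "\<forall>k<s. \<alpha> k \<le> k" by auto
    then have "f = mon_on Z s (restrict \<alpha> {..<s})" "restrict \<alpha> {..<s} \<in> ?W"
      by (auto simp: mon_on_def mon_def fun_eq_iff)
    then show "f \<in> mon_on Z s ` ?W" by blast
  next
    fix f assume "f \<in> mon_on Z s ` ?W"
    then show "f \<in> {mon_on Z s \<alpha> | \<alpha>. \<forall>k<s. \<alpha> k \<le> k}" by fastforce
  qed
  have finW: "finite ?W" by (intro finite_PiE) auto
  have "card ?W = fact s"
    by (simp add: card_PiE fact_prod_Suc lessThan_atLeast0)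
  have "fn.independent (\<delta> ` Z)"
    unfolding fn.dependent_finite[OF finite_imageI[OF finite_Z]]
  proof (safe)
    fix u p assume u: "(\<Sum>v\<in>\<delta> ` Z. (\<lambda>x. u v * v x)) = 0" and p: "p \<in> Z" "u (\<delta> p) \<noteq> 0"
    have ev: "(\<Sum>v\<in>B. (\<lambda>x. u v * v x)) p = (\<Sum>v\<in>B. u v * v p)" for B
      by (induction B rule: infinite_finite_induct) auto
    \<comment> \<open>Evaluation at \<open>p\<close> isolates the coefficient of
      \<open>\<delta> p\<close>.\<close>
    have "0 = (\<Sum>v\<in>\<delta> ` Z. u v * v p)" using u ev[of "\<delta> ` Z"] by simp
    also have "\<dots> = (\<Sum>x\<in>Z. u (\<delta> x) * \<delta> x p)"
      by (subst sum.reindex) (auto intro: inj_on_subset[OF inj_\<delta>])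
    also have "\<dots> = (\<Sum>x\<in>Z. if x = p then u (\<delta> p) else 0)"
      by (intro sum.cong) (auto simp: \<delta>_def)
    also have "\<dots> = u (\<delta> p)" using p finite_Z by simp
    finally show False using p by simp
  qed
  moreover have "\<delta> ` Z \<subseteq> fn.span (mon_on Z s ` ?W)"
    using indicator_in_staircase unfolding box_span_def gen by (auto simp: \<delta>_def)
  ultimately have "card (\<delta> ` Z) \<le> card (mon_on Z s ` ?W)"
    using fn.independent_span_bound[of "mon_on Z s ` ?W" "\<delta> ` Z"] finW by blast
  also have "\<dots> \<le> fact s"
    using card_image_le[OF finW, of "mon_on Z s"] \<open>card ?W = fact s\<close> by simp
  finally show ?thesis by (simp add: card_image inj_on_subset[OF inj_\<delta>])
qed

end

section \<open>Finite fields: characteristic, Frobenius map, roots of unity\<close>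

text \<open>Translation by \<open>1\<close> permutes the field, so summing \<open>x + 1\<close> and
  \<open>x\<close> over it shows that its cardinality vanishes in it. The characteristic is thus a
  prime divisor of \<open>p ^ n\<close>.\<close>

lemma CHAR_eq_of_card_prime_power:
  assumes "prime p" and "card (UNIV :: 'a::{finite,field} set) = p ^ n"
  shows "CHAR('a) = p"
proof -
  have "(\<Sum>x\<in>UNIV. x + 1) = (\<Sum>x\<in>(UNIV :: 'a set). x)"
    by (rule sum.reindex_bij_witness[of _ "\<lambda>x. x - 1" "\<lambda>x. x + 1"]) auto
  then have "of_nat (card (UNIV :: 'a set)) = (0 :: 'a)"
    by (simp add: sum.distrib)
  then have "CHAR('a) dvd p ^ n"
    using assms(2) by (metis of_nat_eq_0_iff_char_dvd)
  moreover have pr: "prime CHAR('a)"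
    by (intro prime_CHAR_semidom finite_imp_CHAR_pos) simp
  ultimately show ?thesis
    using assms(1) prime_dvd_power primes_dvd_imp_eq by blast
qed

text \<open>\<open>q ^ j\<close> is a power of the characteristic, so raising to it is additive;
  this is applied to \<open>(x - y) + y\<close>.\<close>

lemma frobenius_diff:
  fixes x y :: "'a::{finite,field}"
  assumes "prime_power q" and "card (UNIV :: 'a set) = q ^ n"
  shows "(x - y) ^ (q ^ j) = x ^ (q ^ j) - y ^ (q ^ j)"
proof -
  obtain p k where p: "prime p" "q = p ^ k" using assms(1) by (auto simp: prime_power_def)
  then have ch: "CHAR('a) = p"
    using assms(2) by (intro CHAR_eq_of_card_prime_power[of p "k * n"]) (auto simp: power_mult)
  have "((x - y) + y) ^ (q ^ j) = (x - y) ^ (q ^ j) + y ^ (q ^ j)"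
    by (rule freshmans_dream'[of _ "k * j"]) (use p ch in \<open>auto simp: power_mult\<close>)
  then show ?thesis by simp
qed

text \<open>Multiplication by \<open>h\<close> permutes \<open>H\<close>; comparing the nonzero
  product of all elements before and after gives the claim.\<close>

lemma power_card_eq_one:
  fixes H :: "'a::field set"
  assumes "finite H" "0 \<notin> H" and "\<And>x y. x \<in> H \<Longrightarrow> y \<in> H \<Longrightarrow> x * y \<in> H" and h: "h \<in> H"
  shows "h ^ card H = 1"
proof -
  have inj: "inj_on ((*) h) H" using assms by (auto simp: inj_on_def)
  have "(*) h ` H = H" using assms inj by (intro endo_inj_surj) auto
  then have "(\<Prod>x\<in>H. x) = (\<Prod>x\<in>H. h * x)" using inj by (metis prod.reindex_cong)
  also have "\<dots> = h ^ card H * (\<Prod>x\<in>H. x)" by (simp add: prod.distrib)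
  finally show ?thesis using assms by auto
qed

lemma card_roots_of_unity_le:
  fixes t :: nat
  assumes "t > 0"
  shows "card {u :: 'a::field. u ^ t = 1} \<le> t"
proof -
  let ?p = "monom 1 t - 1 :: 'a poly"
  have "coeff ?p 0 \<noteq> 0" using assms by simp
  then have "?p \<noteq> 0" by force
  moreover have "degree ?p \<le> t"
    by (intro degree_diff_le) (auto simp: degree_monom_eq)
  moreover have "{u. poly ?p u = 0} = {u. u ^ t = 1}" by (auto simp: poly_monom)
  ultimately show ?thesis using card_poly_roots_bound[of ?p] by simp
qed

section \<open>Norm equations on an affine line\<close>

text \<open>By additivity of the Frobenius powers, the norm of \<open>z - e i\<close> is the product
  of \<open>z ^ (q ^ j) - e i ^ (q ^ j)\<close> over \<open>j < s\<close>. Hence the vectors of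
  conjugates of the solutions solve a product system.\<close>

lemma card_norm_system_le_fact:
  fixes e B :: "nat \<Rightarrow> 'a::{finite,field}"
  assumes q: "prime_power q" "card (UNIV :: 'a set) = q ^ n" and s: "s > 0" and e: "inj_on e {..<s}"
  shows "card {z. \<forall>i<s. (z - e i) ^ (\<Sum>j<s. q ^ j) = B i} \<le> fact s"
proof -
  let ?S = "{z. \<forall>i<s. (z - e i) ^ (\<Sum>j<s. q ^ j) = B i}"
  let ?v = "\<lambda>z j. z ^ (q ^ j) :: 'a"
  have inj_v: "z = w" if "?v z j = ?v w j" for z w j
    using frobenius_diff[OF q, of z w j] that by simp
  interpret product_system s "\<lambda>i j. ?v (e i) j" B "?v ` ?S"
  proof
    show "inj_on (\<lambda>i. ?v (e i) j) {..<s}" for j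
      using e by (intro inj_onI) (auto dest!: inj_v simp: inj_on_def)
  next
    fix x i assume "x \<in> ?v ` ?S" and i: "i < s"
    then obtain z where "z \<in> ?S" "x = ?v z" by blast
    then show "(\<Prod>j<s. x j - ?v (e i) j) = B i"
      using i by (simp add: frobenius_diff[OF q, symmetric] power_sum)
  next
    fix x y assume "x \<in> ?v ` ?S" "y \<in> ?v ` ?S" and eq: "\<And>j. j < s \<Longrightarrow> x j = y j"
    then obtain z w where "x = ?v z" "y = ?v w" by blast
    \<comment> \<open>Coordinate \<open>0\<close>, present since \<open>s > 0\<close>, is
      \<open>z\<close> itself.\<close>
    then show "x = y" using eq[OF s] inj_v[of z 0 w] by simp
  qed simp
  have "inj_on ?v ?S" by (rule inj_onI) (metis inj_v)
  then show ?thesis using card_solutions_le_fact by (simp add: card_image)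
qed

text \<open>A pair \<open>(x, y)\<close> stands for a common neighbour scaled against vertex
  \<open>s\<close>; the conditions for \<open>i < s\<close> are the other adjacencies.\<close>

lemma card_dual_line_le:
  fixes A B :: "nat \<Rightarrow> 'a::{finite,field}" and H :: "'a set"
  assumes q: "prime_power q" "card (UNIV :: 'a set) = q ^ n" and s: "s > 0" and t: "t > 0"
    and H: "\<And>h. h \<in> H \<Longrightarrow> (h ^ (\<Sum>j<s. q ^ j)) ^ t = 1"
    and det: "\<And>i j. i \<le> s \<Longrightarrow> j \<le> s \<Longrightarrow> i \<noteq> j \<Longrightarrow> A i * B j \<noteq> A j * B i"
  shows "card {(x, y). A s * x + B s * y = 1 \<and> (\<forall>i<s. A i * x + B i * y \<in> H)} \<le> t ^ s * fact s"
    (is "card ?T \<le> _")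
proof (cases "?T = {}")
  case False
  then obtain x0 y0 where x0y0: "A s * x0 + B s * y0 = 1" by auto
  define N :: "'a \<Rightarrow> 'a" where "N x = x ^ (\<Sum>j<s. q ^ j)" for x
  \<comment> \<open>Along the line \<open>(x0 - z * B s, y0 + z * A s)\<close> the
    \<open>i\<close>-th form is affine in \<open>z\<close>, with slope \<open>D i\<close> and zero
    \<open>e i\<close>.\<close>
  define D where "D i = A s * B i - A i * B s" for i
  define e where "e i = - (A i * x0 + B i * y0) / D i" for i
  have D: "D i \<noteq> 0" if "i < s" for i using det[of i s] that by (auto simp: D_def algebra_simps)
  have form: "A i * (x0 - z * B s) + B i * (y0 + z * A s) = D i * (z - e i)" if "i < s" for i z
  proof -
    have "D i * e i = - (A i * x0 + B i * y0)"
      using D[OF that] by (simp only: e_def times_divide_eq_right nonzero_mult_div_cancel_left not_False_eq_True)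
    then have "D i * (z - e i) = D i * z + (A i * x0 + B i * y0)"
      unfolding right_diff_distrib by simp
    then show ?thesis by (simp add: D_def algebra_simps)
  qed
  define S where "S = {z. \<forall>i<s. D i * (z - e i) \<in> H}"
  have "?T \<subseteq> (\<lambda>z. (x0 - z * B s, y0 + z * A s)) ` S"
  proof clarify
    fix x y assume xy: "A s * x + B s * y = 1" and inH: "\<forall>i<s. A i * x + B i * y \<in> H"
    \<comment> \<open>If \<open>A s = 0\<close>, then \<open>y\<close> is constant on the line and
      \<open>x\<close> determines \<open>z\<close>; otherwise \<open>y\<close> does.\<close>
    obtain z where z: "x = x0 - z * B s" "y = y0 + z * A s"
    proof (cases "A s = 0")
      case True
      then have eq: "B s * y0 = 1" "B s * y = 1" using x0y0 xy by simp_all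
      then have "B s \<noteq> 0" by auto
      moreover from this have "y = y0" using eq mult_left_cancel[of "B s" y y0] by simp
      ultimately show ?thesis using True that[of "(x0 - x) / B s"] by simp
    next
      case False
      have "A s * (x0 - x) = B s * (y - y0)" using x0y0 xy by (simp add: algebra_simps)
      then have "x = x0 - (y - y0) / A s * B s" using False by (simp add: field_simps)
      then show ?thesis using False that[of "(y - y0) / A s"] by simp
    qed
    then have "z \<in> S" using inH form unfolding S_def by auto
    then show "(x, y) \<in> (\<lambda>z. (x0 - z * B s, y0 + z * A s)) ` S" using z by blast
  qed
  then have "card ?T \<le> card S"
    by (meson card_image_le card_mono finite order_trans)
  moreover have inj_e: "inj_on e {..<s}"
  proof (rule inj_onI, rule ccontr)
    fix i j assume ij: "i \<in> {..<s}" "j \<in> {..<s}" "e i = e j" "i \<noteq> j"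
    \<comment> \<open>At the common parameter \<open>e i = e j\<close> both forms vanish, so
      Cramer's rule yields the origin, which does not satisfy the equation of vertex
      \<open>s\<close>.\<close>
    define x y where "x = x0 - e i * B s" and "y = y0 + e i * A s"
    have 0: "A i * x + B i * y = 0" "A j * x + B j * y = 0"
      using form[of i "e i"] form[of j "e i"] ij by (auto simp: x_def y_def)
    have "(A i * B j - A j * B i) * x = B j * (A i * x + B i * y) - B i * (A j * x + B j * y)"
      "(A i * B j - A j * B i) * y = A i * (A j * x + B j * y) - A j * (A i * x + B i * y)"
      by (simp_all add: algebra_simps)
    then have "x = 0" "y = 0" using det[of i j] ij unfolding 0 by auto
    moreover have "A s * x + B s * y = 1" using x0y0 by (simp add: x_def y_def algebra_simps)
    ultimately show False by simp
  qed
  moreover have "card S \<le> t ^ s * fact s"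
  proof -
    let ?U = "{u :: 'a. u ^ t = 1}"
    let ?P = "PiE {..<s} (\<lambda>_. ?U)"
    \<comment> \<open>\<open>m i\<close> is the norm of \<open>D i * (z - e i)\<close>, a
      \<open>t\<close>-th root of unity. Since \<open>N\<close> is multiplicative, this prescribes
      \<open>N (z - e i)\<close>.\<close>
    let ?F = "\<lambda>m. {z. \<forall>i<s. N (z - e i) = m i / N (D i)}"
    have "S \<subseteq> (\<Union>m\<in>?P. ?F m)"
    proof
      fix z assume z: "z \<in> S"
      let ?m = "\<lambda>i\<in>{..<s}. N (D i * (z - e i))"
      have "?m \<in> ?P" using z H by (auto simp: S_def N_def)
      moreover have "z \<in> ?F ?m" using D by (auto simp: N_def power_mult_distrib)
      ultimately show "z \<in> (\<Union>m\<in>?P. ?F m)" by blast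
    qed
    then have "card S \<le> card (\<Union>m\<in>?P. ?F m)" by (intro card_mono) auto
    also have "\<dots> \<le> (\<Sum>m\<in>?P. card (?F m))" by (intro card_UN_le finite_PiE) auto
    also have "\<dots> \<le> (\<Sum>m\<in>?P. fact s)"
      unfolding N_def by (intro sum_mono card_norm_system_le_fact[OF q s inj_e])
    also have "\<dots> = card ?U ^ s * fact s" by (simp add: card_PiE)
    also have "\<dots> \<le> t ^ s * fact s"
      using card_roots_of_unity_le[OF t, where 'a = 'a] by (intro mult_right_mono power_mono) auto
    finally show ?thesis .
  qed
  ultimately show ?thesis by linarith
next
  case True
  show ?thesis unfolding True by simp
qed

section \<open>Vertices and adjacency\<close>

locale field_subgroup =
  fixes H :: "'a::field set"
  assumes zero: "0 \<notin> H" and one: "1 \<in> H"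
    and mult: "\<And>x y. x \<in> H \<Longrightarrow> y \<in> H \<Longrightarrow> x * y \<in> H"
    and inv: "\<And>x. x \<in> H \<Longrightarrow> inverse x \<in> H"
begin

lemma pair_rel_iff:
  "((a, b), (x, y)) \<in> pair_rel H \<longleftrightarrow> (a, b) \<noteq> (0, 0) \<and> (x, y) \<noteq> (0, 0) \<and> (\<exists>h\<in>H. a = h * x \<and> b = h * y)"
  by (simp add: pair_rel_def)

lemma equiv_pair_rel: "equiv (UNIV - {(0, 0)}) (pair_rel H)"
proof (rule equivI)
  show "pair_rel H \<subseteq> (UNIV - {(0, 0)}) \<times> (UNIV - {(0, 0)})"
    by (auto simp: pair_rel_def)
  show "refl_on (UNIV - {(0, 0)}) (pair_rel H)"
    using one by (auto simp: refl_on_def pair_rel_iff intro!: bexI[of _ 1])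
  show "sym (pair_rel H)"
  proof (rule symI, clarify)
    fix a b x y assume "((a, b), (x, y)) \<in> pair_rel H"
    then obtain h where h: "h \<in> H" "a = h * x" "b = h * y" "(a, b) \<noteq> (0, 0)" "(x, y) \<noteq> (0, 0)"
      by (auto simp: pair_rel_iff)
    moreover have "h \<noteq> 0" using h zero by auto
    ultimately show "((x, y), (a, b)) \<in> pair_rel H"
      unfolding pair_rel_iff using inv by (intro conjI bexI[of _ "inverse h"]) auto
  qed
  show "trans (pair_rel H)"
  proof (rule transI, clarify)
    fix a b x y u v assume "((a, b), (x, y)) \<in> pair_rel H" "((x, y), (u, v)) \<in> pair_rel H"
    then obtain h k where "h \<in> H" "k \<in> H" "a = h * x" "b = h * y" "x = k * u" "y = k * v"
      "(a, b) \<noteq> (0, 0)" "(u, v) \<noteq> (0, 0)"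
      by (auto simp: pair_rel_iff)
    then show "((a, b), (u, v)) \<in> pair_rel H"
      unfolding pair_rel_iff using mult by (intro conjI bexI[of _ "h * k"]) (auto simp: mult.assoc)
  qed
qed

lemma vertex_nonempty: "P \<in> G_verts H \<Longrightarrow> \<exists>a b. (a, b) \<in> P"
  using in_quotient_imp_non_empty[OF equiv_pair_rel] by (fastforce simp: G_verts_def)

lemma vertex_scale:
  assumes P: "P \<in> G_verts H" "(a, b) \<in> P" and h: "h \<in> H"
  shows "(h * a, h * b) \<in> P"
proof -
  have "(a, b) \<noteq> (0, 0)" 
    using in_quotient_imp_subset[OF equiv_pair_rel, of P] P by (auto simp: G_verts_def)
  moreover have "h \<noteq> 0" using h zero by auto
  ultimately have "((h * a, h * b), (a, b)) \<in> pair_rel H"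
    unfolding pair_rel_iff using h by auto
  then have "((a, b), (h * a, h * b)) \<in> pair_rel H"
    using equiv_pair_rel by (meson equivE symE)
  then show ?thesis
    using in_quotient_imp_closed[OF equiv_pair_rel] P unfolding G_verts_def by blast
qed

lemma vertices_eqI:
  assumes P: "P \<in> G_verts H" "(a, b) \<in> P" and Q: "Q \<in> G_verts H" "(h * a, h * b) \<in> Q" and h: "h \<in> H"
  shows "P = Q"
  using vertex_scale[OF P h] P Q quotient_disj[OF equiv_pair_rel, of P Q] by (auto simp: G_verts_def)

text \<open>Other representatives multiply the value \<open>a * x + b * y\<close> by a product of
  two elements of \<open>H\<close>, so the existential in \<open>G_adj\<close> may be read
  universally.\<close>

lemma G_adj_representatives:
  assumes adj: "G_adj H P Q" and P: "P \<in> G_verts H" "(a, b) \<in> P" and Q: "Q \<in> G_verts H" "(x, y) \<in> Q"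
  shows "a * x + b * y \<in> H"
proof -
  obtain a' b' x' y' where 1: "(a', b') \<in> P" "(x', y') \<in> Q" "a' * x' + b' * y' \<in> H"
    using adj by (auto simp: G_adj_def)
  have "((a, b), (a', b')) \<in> pair_rel H" "((x, y), (x', y')) \<in> pair_rel H"
    using 1 P Q in_quotient_imp_in_rel[OF equiv_pair_rel] unfolding G_verts_def by blast+
  then obtain h k where hk: "h \<in> H" "k \<in> H" "a = h * a'" "b = h * b'" "x = k * x'" "y = k * y'"
    by (auto simp: pair_rel_iff)
  then have "a * x + b * y = h * k * (a' * x' + b' * y')" by (simp add: algebra_simps)
  then show ?thesis using hk 1 mult by auto
qed

text \<open>The values \<open>u\<close> and \<open>v\<close> at the common neighbour lie in
  \<open>H\<close>. If the pairs are proportional, the ratio is \<open>v / u\<close>, again in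
  \<open>H\<close>, so the classes coincide.\<close>

lemma common_neighbour_imp_independent:
  assumes adj: "G_adj H P R" "G_adj H Q R"
    and P: "P \<in> G_verts H" "(a, b) \<in> P" and Q: "Q \<in> G_verts H" "(c, d) \<in> Q"
    and R: "R \<in> G_verts H" and det: "a * d = c * b"
  shows "P = Q"
proof -
  obtain x y where xy: "(x, y) \<in> R" using vertex_nonempty[OF R] by auto
  define u v where "u = a * x + b * y" and "v = c * x + d * y"
  have uv: "u \<in> H" "v \<in> H"
    using G_adj_representatives[OF adj(1) P R xy] G_adj_representatives[OF adj(2) Q R xy]
    by (auto simp: u_def v_def)
  then have nz: "u \<noteq> 0" "v \<noteq> 0" using zero by auto
  have "u * c = v * a"
  proof -
    have "u * c - v * a = y * (c * b - a * d)" by (simp add: u_def v_def algebra_simps)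
    then show ?thesis using det by simp
  qed
  moreover have "u * d = v * b"
  proof -
    have "u * d - v * b = x * (a * d - c * b)" by (simp add: u_def v_def algebra_simps)
    then show ?thesis using det by simp
  qed
  ultimately have "c = v * inverse u * a" "d = v * inverse u * b"
    using nz by (auto simp: field_simps)
  then show ?thesis
    using vertices_eqI[OF P Q(1), of "v * inverse u"] Q uv mult inv by auto
qed

end

section \<open>Excluding the complete bipartite subgraph\<close>

theorem theorem8:
  fixes q r t :: nat and H :: "'a::{finite,field} set"
  assumes "prime_power q" and "r \<ge> 2" and "t > 0" and "t dvd q - 1"
    and "card (UNIV :: 'a set) = q ^ (r - 1)"
    and "H \<subseteq> UNIV - {0}" and "1 \<in> H"
    and "\<forall>x\<in>H. \<forall>y\<in>H. x * y \<in> H" and "\<forall>x\<in>H. inverse x \<in> H"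
    and "card H = t * (\<Sum>i<r - 1. q ^ i)"
  shows "Ksu_free (G_verts H) (G_adj H) r (t ^ (r - 1) * (fact (r - 1) :: nat) + 1)"
  unfolding Ksu_free_def
proof (rule notI, elim exE conjE)
  interpret field_subgroup H by standard (use assms in auto)
  fix S U assume S: "S \<subseteq> G_verts H" "finite S" "card S = r"
    and U: "U \<subseteq> G_verts H" "finite U" "card U = t ^ (r - 1) * fact (r - 1) + 1"
    and adj: "\<forall>P\<in>S. \<forall>Q\<in>U. G_adj H P Q"
  define s where "s = r - 1"
  have s: "s > 0" "r = Suc s" using assms(2) by (auto simp: s_def)
  obtain P where P: "bij_betw P {..<r} S"
    using ex_bij_betw_nat_finite[OF S(2)] S(3) by (auto simp: lessThan_atLeast0)
  have PS: "P i \<in> S" if "i \<le> s" for i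
    using P that s by (auto simp: bij_betw_def)
  then have PV: "P i \<in> G_verts H" if "i \<le> s" for i using that S by auto
  have "\<forall>i. \<exists>a b. i \<le> s \<longrightarrow> (a, b) \<in> P i" using vertex_nonempty PV by blast
  then obtain A B where AB: "\<And>i. i \<le> s \<Longrightarrow> (A i, B i) \<in> P i" by metis
  have "\<exists>x y. (x, y) \<in> Q \<and> A s * x + B s * y = 1" if Q: "Q \<in> U" for Q
  proof -
    obtain x y where xy: "(x, y) \<in> Q" using vertex_nonempty Q U by blast
    \<comment> \<open>Since this value lies in \<open>H\<close>, dividing by it stays inside the
      class \<open>Q\<close>.\<close>
    define h where "h = A s * x + B s * y"
    have h: "h \<in> H"
      unfolding h_def using adj PS PV AB Q U xy by (intro G_adj_representatives[of "P s" Q]) auto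
    then have "h \<noteq> 0" using zero by auto
    have "(inverse h * x, inverse h * y) \<in> Q" using vertex_scale[of Q x y "inverse h"] Q U xy inv h by auto
    moreover have "A s * (inverse h * x) + B s * (inverse h * y) = inverse h * h"
      by (simp add: h_def algebra_simps)
    ultimately show ?thesis using \<open>h \<noteq> 0\<close> by auto
  qed
  then obtain X Y where XY: "\<And>Q. Q \<in> U \<Longrightarrow> (X Q, Y Q) \<in> Q"
    and norm: "\<And>Q. Q \<in> U \<Longrightarrow> A s * X Q + B s * Y Q = 1" by metis
  let ?T = "{(x, y). A s * x + B s * y = 1 \<and> (\<forall>i<s. A i * x + B i * y \<in> H)}"
  \<comment> \<open>One common neighbour \<open>R\<close> is enough to make the vertices of
    \<open>S\<close> pairwise independent; the \<open>+ 1\<close> in the size of \<open>U\<close>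
    provides it.\<close>
  have "U \<noteq> {}" using U by auto
  then obtain R where R: "R \<in> U" by auto
  have "card ?T \<le> t ^ s * fact s"
  proof (rule card_dual_line_le[OF assms(1,5) s(1) assms(3)])
    fix h assume "h \<in> H"
    then have "h ^ card H = 1" using mult zero by (intro power_card_eq_one) auto
    then show "(h ^ (\<Sum>j<s. q ^ j)) ^ t = 1"
      using assms(10) by (simp add: s_def power_mult[symmetric] mult.commute)
  next
    fix i j assume ij: "i \<le> s" "j \<le> s" "i \<noteq> j"
    have "P i \<noteq> P j" using P ij s by (auto simp: bij_betw_def inj_on_def)
    then show "A i * B j \<noteq> A j * B i"
      using common_neighbour_imp_independent[of "P i" R "P j"] ij adj PS PV AB R U by blast
  qed
  \<comment> \<open>Distinct classes are disjoint, so a normalized pair determines its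
    class.\<close>
  moreover have "inj_on (\<lambda>Q. (X Q, Y Q)) U"
  proof (rule inj_onI)
    fix Q Q' assume "Q \<in> U" "Q' \<in> U" "(X Q, Y Q) = (X Q', Y Q')"
    then show "Q = Q'" using vertices_eqI[of Q "X Q" "Y Q" Q' 1] one XY[of Q] XY[of Q'] U by auto
  qed
  then have "card U \<le> card ?T"
  proof (rule card_inj_on_le)
    show "(\<lambda>Q. (X Q, Y Q)) ` U \<subseteq> ?T"
    proof (rule image_subsetI)
      fix Q assume Q: "Q \<in> U"
      have "A i * X Q + B i * Y Q \<in> H" if "i < s" for i
        using adj PS PV AB U XY Q that by (intro G_adj_representatives[of "P i" Q]) auto
      then show "(X Q, Y Q) \<in> ?T"
        using norm[OF Q] by simp
    qed
  qed simp
  ultimately show False using U by (simp add: s_def)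
qed

end
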